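(* Let $n\ge 1$ and let $\varphi:\mathbb{H}_{3}\longrightarrow \mathbb{R}^{n}$, $\varphi(X)=AX$, be a linear map from Heisenberg space $\mathbb{H}_3$ (with coordinates $X=(x,y,z)^t$) into Euclidean space, where $A$ is a real $n\times 3$ matrix with column vectors $A_1, A_2, A_3\in\mathbb{R}^n$. Then $\varphi$ is $\infty$-harmonic if and only if $A_3=0$, or $A_1$, $A_2$ and $A_3$ are proportional to each other.
   Context: A smooth map $\varphi:(M,g)\to(N,h)$ between Riemannian manifolds is called $\infty$-harmonic if $\mathrm{d}\varphi(\mathrm{grad}\,|\mathrm{d}\varphi|^2)=0$ on $M$, where $|\mathrm{d}\varphi|^2=\mathrm{Trace}_g\,\varphi^*h$ is the energy density of $\varphi$ and $\mathrm{grad}$ is the gradient with respect to $g$. Heisenberg space is $\mathbb{H}_3=(\mathbb{R}^3,g)$ with, in the standard coordinates $(x,y,z)$, the metric $g=\mathrm{d}x^2+\mathrm{d}y^2+\left(\mathrm{d}z+\frac{y}{2}\mathrm{d}x-\frac{x}{2}\mathrm{d}y\right)^2$. The space $\mathbb{R}^n$ carries the standard Euclidean metric. A linear map means a map that is linear in these standard coordinates. Vectors are "proportional to each other" if any two of them are linearly dependent (parallel, the zero vector being allowed). *)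

theory Defs
  imports "HOL-Analysis.Analysis"
begin

primrec C_times :: "nat \<Rightarrow> ('a::real_normed_vector \<Rightarrow> 'b::real_normed_vector) \<Rightarrow> bool" where
  "C_times 0 f \<longleftrightarrow> continuous_on UNIV f"
| "C_times (Suc k) f \<longleftrightarrow>
     (\<forall>x. f differentiable (at x)) \<and> (\<forall>v. C_times k (\<lambda>x. frechet_derivative f (at x) v))"

text \<open>On a finite-dimensional domain this is the usual notion of a \<open>C\<^sup>\<infinity>\<close> map: continuity of all
  directional derivatives \<open>x \<mapsto> Df(x) v\<close> is the same as continuity of \<open>Df\<close>.\<close>

definition smooth :: "('a::euclidean_space \<Rightarrow> 'b::real_normed_vector) \<Rightarrow> bool" where
  "smooth f \<longleftrightarrow> (\<forall>k. C_times k f)"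

text \<open>A metric on \<open>\<real>\<^sup>m\<close>, in the standard global chart: \<open>g p v w\<close> is the inner product of the
  tangent vectors \<open>v\<close> and \<open>w\<close> at \<open>p\<close>, both given by their components in the coordinate frame.\<close>

type_synonym 'm metric = "real^'m \<Rightarrow> real^'m \<Rightarrow> real^'m \<Rightarrow> real"

definition riemannian_metric :: "'m::finite metric \<Rightarrow> bool" where
  "riemannian_metric g \<longleftrightarrow>
     (\<forall>p. bilinear (g p) \<and> (\<forall>v w. g p v w = g p w v) \<and> (\<forall>v. v \<noteq> 0 \<longrightarrow> g p v v > 0)) \<and>
     (\<forall>v w. smooth (\<lambda>p. g p v w))"

definition coord_matrix :: "(real^'m \<Rightarrow> real^'m \<Rightarrow> real) \<Rightarrow> real^'m^'m" where
  "coord_matrix b = (\<chi> i j. b (axis i 1) (axis j 1))"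

text \<open>\<open>grad f = g\<^sup>i\<^sup>j \<partial>\<^sub>j f \<partial>\<^sub>i\<close>, where \<open>g\<^sup>i\<^sup>j\<close> are the entries of the inverse of the matrix of \<open>g\<close>.\<close>

definition riem_grad :: "'m::finite metric \<Rightarrow> (real^'m \<Rightarrow> real) \<Rightarrow> real^'m \<Rightarrow> real^'m" where
  "riem_grad g f p =
     matrix_inv (coord_matrix (g p)) *v (\<chi> j. frechet_derivative f (at p) (axis j 1))"

text \<open>\<open>Trace\<^sub>g b = g\<^sup>i\<^sup>j b\<^sub>i\<^sub>j\<close>, for a bilinear form \<open>b\<close> on the tangent space at \<open>p\<close>.\<close>

definition metric_trace ::
    "'m::finite metric \<Rightarrow> real^'m \<Rightarrow> (real^'m \<Rightarrow> real^'m \<Rightarrow> real) \<Rightarrow> real" where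
  "metric_trace g p b = trace (matrix_inv (coord_matrix (g p)) ** coord_matrix b)"

definition pullback ::
    "(real^'m::finite \<Rightarrow> real^'n::finite) \<Rightarrow> 'n metric \<Rightarrow> 'm metric" where
  "pullback \<phi> h p v w =
     h (\<phi> p) (frechet_derivative \<phi> (at p) v) (frechet_derivative \<phi> (at p) w)"

definition energy_density ::
    "'m::finite metric \<Rightarrow> 'n::finite metric \<Rightarrow> (real^'m \<Rightarrow> real^'n) \<Rightarrow> real^'m \<Rightarrow> real" where
  "energy_density g h \<phi> p = metric_trace g p (pullback \<phi> h p)"

definition infinity_harmonic ::
    "'m::finite metric \<Rightarrow> 'n::finite metric \<Rightarrow> (real^'m \<Rightarrow> real^'n) \<Rightarrow> bool" where
  "infinity_harmonic g h \<phi> \<longleftrightarrow>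
     smooth \<phi> \<and>
     (\<forall>p. frechet_derivative \<phi> (at p) (riem_grad g (energy_density g h \<phi>) p) = 0)"

definition flat_metric :: "'n::finite metric" where
  "flat_metric p v w = v \<bullet> w"

text \<open>The contact form \<open>dz + (y/2) dx - (x/2) dy\<close>, evaluated at the point \<open>p = (x, y, z)\<close>.\<close>

definition heisenberg_form :: "real^3 \<Rightarrow> real^3 \<Rightarrow> real" where
  "heisenberg_form p v = v $ 3 + p $ 2 / 2 * v $ 1 - p $ 1 / 2 * v $ 2"

definition heisenberg_metric :: "3 metric" where
  "heisenberg_metric p v w =
     v $ 1 * w $ 1 + v $ 2 * w $ 2 + heisenberg_form p v * heisenberg_form p w"

text \<open>Linear dependence of the pair \<open>(u, v)\<close>. Not the same as \<open>dependent {u, v}\<close>, which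
  is false for \<open>u = v \<noteq> 0\<close> because the set then has a single element.\<close>

definition proportional :: "'a::real_vector \<Rightarrow> 'a \<Rightarrow> bool" where
  "proportional u v \<longleftrightarrow> (\<exists>a b. (a \<noteq> 0 \<or> b \<noteq> 0) \<and> a *\<^sub>R u + b *\<^sub>R v = 0)"

lemma C_times_const: "C_times k (\<lambda>x. c)"
  by (induction k arbitrary: c) auto

lemma C_times_Suc_D: "C_times (Suc k) f \<Longrightarrow> C_times k f"
proof (induction k arbitrary: f)
  case 0
  then show ?case
    by (auto simp: continuous_on_eq_continuous_at differentiable_imp_continuous_within)
next
  case (Suc k)
  then show ?case by (metis C_times.simps(2))
qed

lemma C_times_linear:
  assumes "bounded_linear f" shows "C_times k f"
proof (cases k)
  case 0
  then show ?thesis by (simp add: assms linear_continuous_on)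
next
  case (Suc m)
  have "frechet_derivative f (at x) = f" for x
    using assms bounded_linear_imp_has_derivative frechet_derivative_at by metis
  then show ?thesis
    using Suc assms by (auto simp: C_times_const bounded_linear_imp_differentiable)
qed

lemma C_times_add: "C_times k f \<Longrightarrow> C_times k g \<Longrightarrow> C_times k (\<lambda>x. f x + g x)"
proof (induction k arbitrary: f g)
  case 0
  then show ?case by (auto intro: continuous_on_add)
next
  case (Suc k)
  have "frechet_derivative (\<lambda>x. f x + g x) (at x) =
      (\<lambda>v. frechet_derivative f (at x) v + frechet_derivative g (at x) v)" for x
    by (rule frechet_derivative_at[symmetric])
       (use Suc.prems in \<open>auto intro!: has_derivative_add simp: frechet_derivative_works\<close>)
  then show ?case using Suc by auto
qed

lemma C_times_mult:
  fixes f g :: "'a::real_normed_vector \<Rightarrow> real"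
  shows "C_times k f \<Longrightarrow> C_times k g \<Longrightarrow> C_times k (\<lambda>x. f x * g x)"
proof (induction k arbitrary: f g)
  case 0
  then show ?case by (auto intro: continuous_on_mult)
next
  case (Suc k)
  have "frechet_derivative (\<lambda>x. f x * g x) (at x) =
      (\<lambda>v. f x * frechet_derivative g (at x) v + frechet_derivative f (at x) v * g x)" for x
    by (rule frechet_derivative_at[symmetric])
       (use Suc.prems in \<open>auto intro!: has_derivative_mult simp: frechet_derivative_works\<close>)
  moreover have "C_times k f" "C_times k g"
    using Suc.prems C_times_Suc_D by blast+
  ultimately show ?case using Suc by (auto intro!: C_times_add)
qed

lemma riemannian_flat: "riemannian_metric (flat_metric :: 'n::finite metric)"
  by (auto simp: riemannian_metric_def flat_metric_def smooth_def C_times_const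
      inner_commute bilinear_def intro!: linearI simp: inner_simps)

lemma riemannian_heisenberg: "riemannian_metric heisenberg_metric"
  unfolding riemannian_metric_def
proof (intro conjI allI impI)
  fix p v w :: "real^3"
  show "bilinear (heisenberg_metric p)"
    by (auto simp: bilinear_def heisenberg_metric_def heisenberg_form_def algebra_simps
        add_divide_distrib intro!: linearI)
  show "heisenberg_metric p v w = heisenberg_metric p w v"
    by (simp add: heisenberg_metric_def mult.commute)
  show "heisenberg_metric p v v > 0" if "v \<noteq> 0"
  proof (rule ccontr)
    assume "\<not> ?thesis"
    then have *: "(v $ 1)\<^sup>2 + (v $ 2)\<^sup>2 + (heisenberg_form p v)\<^sup>2 \<le> 0"
      by (simp add: heisenberg_metric_def power2_eq_square)
    have "v $ 1 = 0" "v $ 2 = 0" "heisenberg_form p v = 0"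
      using * zero_le_power2[of "v $ 1"] zero_le_power2[of "v $ 2"]
        zero_le_power2[of "heisenberg_form p v"]
      by (metis add_nonneg_eq_0_iff add_nonneg_nonneg antisym power_eq_0_iff)+
    then have "v = 0" by (simp add: heisenberg_form_def vec_eq_iff forall_3)
    with that show False by simp
  qed
  have form: "C_times k (\<lambda>p. heisenberg_form p v)" for k and v :: "real^3"
  proof -
    have "C_times k (\<lambda>p::real^3. v $ 3 + (p $ 2 * (v $ 1 / 2) + p $ 1 * (- v $ 2 / 2)))"
      by (intro C_times_add C_times_mult C_times_const C_times_linear bounded_linear_vec_nth)
    also have "(\<lambda>p::real^3. v $ 3 + (p $ 2 * (v $ 1 / 2) + p $ 1 * (- v $ 2 / 2))) =
        (\<lambda>p. heisenberg_form p v)"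
      by (auto simp: heisenberg_form_def)
    finally show ?thesis .
  qed
  show "smooth (\<lambda>p. heisenberg_metric p v w)"
    unfolding smooth_def heisenberg_metric_def
    by (intro allI C_times_add C_times_mult C_times_const form)
qed

lemma riem_grad_unique:
  assumes g: "riemannian_metric g" and f: "f differentiable (at p)"
  shows "(\<forall>v. g p u v = frechet_derivative f (at p) v) \<longleftrightarrow> u = riem_grad g f p"
proof -
  let ?G = "coord_matrix (g p)" and ?d = "frechet_derivative f (at p)"
  have bil: "bilinear (g p)" and sym: "\<And>v w. g p v w = g p w v"
    and pos: "\<And>v. v \<noteq> 0 \<Longrightarrow> g p v v > 0"
    using g by (auto simp: riemannian_metric_def)
  have lin: "linear (g p v)" for v using bil by (simp add: bilinear_def)
  have row: "(?G *v u) $ i = g p u (axis i 1)" for u i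
  proof -
    have "g p (axis i 1) u = g p (axis i 1) (\<Sum>j\<in>UNIV. u $ j *\<^sub>R axis j 1)"
      by (simp add: basis_expansion flip: scalar_mult_eq_scaleR)
    also have "\<dots> = (\<Sum>j\<in>UNIV. u $ j * g p (axis i 1) (axis j 1))"
      by (simp add: linear_sum[OF lin] linear_scale[OF lin])
    finally show ?thesis
      by (simp add: matrix_vector_mult_def coord_matrix_def sym[of u] mult.commute)
  qed
  have "u = 0" if "?G *v u = 0" for u
  proof -
    have "g p u u = g p u (\<Sum>j\<in>UNIV. u $ j *\<^sub>R axis j 1)"
      by (simp add: basis_expansion flip: scalar_mult_eq_scaleR)
    also have "\<dots> = (\<Sum>j\<in>UNIV. u $ j * g p u (axis j 1))"
      by (simp add: linear_sum[OF lin] linear_scale[OF lin])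
    also have "\<dots> = 0" using that by (simp flip: row)
    finally show "u = 0" using pos by force
  qed
  then have "invertible ?G"
    by (meson invertible_left_inverse matrix_left_invertible_ker)
  then have matrix_inv: "?G ** matrix_inv ?G = mat 1" "matrix_inv ?G ** ?G = mat 1"
    unfolding invertible_def matrix_inv_def by (metis (mono_tags, lifting) someI_ex)+
  have d: "linear ?d" using f frechet_derivative_works has_derivative_linear by blast
  have "(\<forall>v. g p u v = ?d v) \<longleftrightarrow> (\<forall>j. g p u (axis j 1) = ?d (axis j 1))"
  proof (intro iffI allI)
    fix v assume "\<forall>j. g p u (axis j 1) = ?d (axis j 1)"
    then have "g p u = ?d"
      by (intro linear_eq_stdbasis[OF lin d]) (auto simp: Basis_vec_def)
    then show "g p u v = ?d v" by simp
  qed auto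
  also have "\<dots> \<longleftrightarrow> ?G *v u = (\<chi> j. ?d (axis j 1))"
    by (simp add: vec_eq_iff row)
  also have "\<dots> \<longleftrightarrow> u = riem_grad g f p"
    unfolding riem_grad_def using matrix_inv
    by (metis matrix_vector_mul_assoc matrix_vector_mul_lid)
  finally show ?thesis .
qed

end

theory Submission
  imports Defs
begin

text \<open>The frame \<open>e\<^sub>1 = \<partial>\<^sub>x - (y/2) \<partial>\<^sub>z\<close>, \<open>e\<^sub>2 = \<partial>\<^sub>y + (x/2) \<partial>\<^sub>z\<close>, \<open>e\<^sub>3 = \<partial>\<^sub>z\<close> is orthonormal, and
  \<open>d\<phi>\<close> maps it to \<open>A\<^sub>1 - (y/2) A\<^sub>3\<close>, \<open>A\<^sub>2 + (x/2) A\<^sub>3\<close>, \<open>A\<^sub>3\<close>. The energy density is therefore a quadratic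
  polynomial in \<open>x\<close> and \<open>y\<close>, and \<open>d\<phi>(grad |d\<phi>|\<^sup>2)\<close> is up to a factor \<open>2\<close> equal to
  \<open>2 ((A\<^sub>2 \<bullet> A\<^sub>3) A\<^sub>1 - (A\<^sub>1 \<bullet> A\<^sub>3) A\<^sub>2) + x (|A\<^sub>3|\<^sup>2 A\<^sub>1 - (A\<^sub>1 \<bullet> A\<^sub>3) A\<^sub>3) + y (|A\<^sub>3|\<^sup>2 A\<^sub>2 - (A\<^sub>2 \<bullet> A\<^sub>3) A\<^sub>3)\<close>.
  The coefficients of \<open>x\<close> and \<open>y\<close> vanish exactly when \<open>A\<^sub>3 = 0\<close> or \<open>A\<^sub>1\<close> and \<open>A\<^sub>2\<close> are multiples of
  \<open>A\<^sub>3\<close>, and then the constant coefficient vanishes as well.\<close>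

lemma matrix_inv_eqI:
  fixes A B :: "'a::field^'n^'n"
  assumes "A ** B = mat 1"
  shows "matrix_inv A = B"
proof -
  have BA: "B ** A = mat 1"
    using assms by (simp add: matrix_left_right_inverse)
  have "A ** matrix_inv A = mat 1 \<and> matrix_inv A ** A = mat 1"
    unfolding matrix_inv_def by (rule someI[of _ B]) (simp add: assms BA)
  then show ?thesis
    by (metis BA matrix_mul_assoc matrix_mul_lid matrix_mul_rid)
qed

text \<open>The inverse Gram matrix is the sum of the products
  \<open>e\<^sub>i e\<^sub>i\<^sup>T\<close> over the orthonormal frame.\<close>

lemma matrix_inv_heisenberg:
  "matrix_inv (coord_matrix (heisenberg_metric p)) =
    vector [vector [1, 0, - (p $ 2 / 2)],
            vector [0, 1, p $ 1 / 2],
            vector [- (p $ 2 / 2), p $ 1 / 2, 1 + ((p $ 1)\<^sup>2 + (p $ 2)\<^sup>2) / 4]]"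
  by (rule matrix_inv_eqI)
     (simp add: vec_eq_iff forall_3 matrix_matrix_mult_def sum_3 coord_matrix_def mat_def
       heisenberg_metric_def heisenberg_form_def axis_def field_simps power2_eq_square)

lemma frechet_derivative_matrix_vector_mult:
  fixes A :: "real^'m^'n"
  shows "frechet_derivative (\<lambda>X. A *v X) (at p) = (\<lambda>X. A *v X)"
  by (rule frechet_derivative_at[symmetric])
     (intro bounded_linear_imp_has_derivative matrix_vector_mul_bounded_linear)

lemma smooth_matrix_vector_mult:
  fixes A :: "real^'m^'n"
  shows "smooth (\<lambda>X. A *v X)"
  by (simp add: smooth_def C_times_linear matrix_vector_mul_bounded_linear)

lemma matrix_vector_mult_3:
  fixes A :: "real^3^'n"
  shows "A *v v = v $ 1 *\<^sub>R column 1 A + v $ 2 *\<^sub>R column 2 A + v $ 3 *\<^sub>R column 3 A"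
  by (simp add: matrix_mult_sum sum_3 scalar_mult_eq_scaleR)

lemma energy_density_heisenberg_linear:
  fixes A :: "real^3^'n"
  defines "A1 \<equiv> column 1 A" and "A2 \<equiv> column 2 A" and "A3 \<equiv> column 3 A"
  shows "energy_density heisenberg_metric flat_metric (\<lambda>X. A *v X) p =
    A1 \<bullet> A1 + A2 \<bullet> A2 + A3 \<bullet> A3 - p $ 2 * (A1 \<bullet> A3) + p $ 1 * (A2 \<bullet> A3)
      + ((p $ 1)\<^sup>2 + (p $ 2)\<^sup>2) / 4 * (A3 \<bullet> A3)"
  unfolding energy_density_def metric_trace_def matrix_inv_heisenberg trace_def
  by (simp add: sum_3 matrix_matrix_mult_def coord_matrix_def pullback_def flat_metric_def
      frechet_derivative_matrix_vector_mult matrix_vector_mult_basis A1_def A2_def A3_def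
      inner_commute field_simps)

text \<open>The density does not depend on z, so its partial derivatives \<open>a\<close> and
  \<open>b\<close> are also its derivatives along \<open>e\<^sub>1\<close> and
  \<open>e\<^sub>2\<close>, and the gradient is \<open>a e\<^sub>1 + b e\<^sub>2\<close>.\<close>

lemma riem_grad_energy_heisenberg_linear:
  fixes A :: "real^3^'n" and p :: "real^3"
  defines "A1 \<equiv> column 1 A" and "A2 \<equiv> column 2 A" and "A3 \<equiv> column 3 A"
  defines "a \<equiv> A2 \<bullet> A3 + p $ 1 / 2 * (A3 \<bullet> A3)"
    and "b \<equiv> p $ 2 / 2 * (A3 \<bullet> A3) - A1 \<bullet> A3"
  shows "riem_grad heisenberg_metric (energy_density heisenberg_metric flat_metric (\<lambda>X. A *v X)) p
    = vector [a, b, p $ 1 / 2 * b - p $ 2 / 2 * a]"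
proof -
  have nth: "((\<lambda>p::real^3. p $ i) has_derivative (\<lambda>v. v $ i)) (at p)" for i
    by (intro bounded_linear_imp_has_derivative bounded_linear_vec_nth)
  have "(energy_density heisenberg_metric flat_metric (\<lambda>X. A *v X) has_derivative
      (\<lambda>v. v $ 1 * a + v $ 2 * b)) (at p)"
    unfolding energy_density_heisenberg_linear[abs_def]
    by (rule derivative_eq_intros nth | simp)+
       (simp add: fun_eq_iff a_def b_def A1_def A2_def A3_def field_simps)
  then have "frechet_derivative (energy_density heisenberg_metric flat_metric (\<lambda>X. A *v X)) (at p)
      = (\<lambda>v. v $ 1 * a + v $ 2 * b)"
    by (rule frechet_derivative_at[symmetric])
  then show ?thesis
    by (simp add: riem_grad_def matrix_inv_heisenberg vec_eq_iff forall_3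
        matrix_vector_mult_def sum_3 axis_def)
qed

lemma infinity_harmonic_heisenberg_linear_iff:
  fixes A :: "real^3^'n"
  defines "A1 \<equiv> column 1 A" and "A2 \<equiv> column 2 A" and "A3 \<equiv> column 3 A"
  shows "infinity_harmonic heisenberg_metric flat_metric (\<lambda>X. A *v X) \<longleftrightarrow>
    (\<forall>x y. (2 * (A2 \<bullet> A3)) *\<^sub>R A1 - (2 * (A1 \<bullet> A3)) *\<^sub>R A2
      + x *\<^sub>R ((A3 \<bullet> A3) *\<^sub>R A1 - (A1 \<bullet> A3) *\<^sub>R A3)
      + y *\<^sub>R ((A3 \<bullet> A3) *\<^sub>R A2 - (A2 \<bullet> A3) *\<^sub>R A3) = 0)" (is "_ \<longleftrightarrow> (\<forall>x y. ?T x y = 0)")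
proof -
  let ?E = "energy_density heisenberg_metric flat_metric (\<lambda>X. A *v X)"
  \<comment> \<open>The factor 2 clears the halves. The xy terms in the coefficient of
    \<open>A3\<close> cancel, which leaves \<open>?T\<close> affine in x and y.\<close>
  have eq: "2 *\<^sub>R (A *v riem_grad heisenberg_metric ?E p) = ?T (p $ 1) (p $ 2)" for p
    unfolding riem_grad_energy_heisenberg_linear
    unfolding matrix_vector_mult_3
    by (simp add: vec_eq_iff A1_def A2_def A3_def field_simps)
  have "infinity_harmonic heisenberg_metric flat_metric (\<lambda>X. A *v X) \<longleftrightarrow>
      (\<forall>p. 2 *\<^sub>R (A *v riem_grad heisenberg_metric ?E p) = 0)"
    by (simp add: infinity_harmonic_def smooth_matrix_vector_mult
        frechet_derivative_matrix_vector_mult)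
  \<comment> \<open>Every pair (x, y) occurs as the first two coordinates of a point.\<close>
  also have "\<dots> \<longleftrightarrow> (\<forall>x y. ?T x y = 0)"
    unfolding eq by (metis vector_3(1,2))
  finally show ?thesis .
qed

lemma proportional_multiples: "proportional (c *\<^sub>R w) (d *\<^sub>R w)"
\<comment> \<open>The relation with coefficients \<open>d\<close> and \<open>- c\<close> could be
  trivial if \<open>c = 0\<close>; that case takes 1 and 0 instead.\<close>
proof (cases "c = 0")
  case True
  then show ?thesis
    unfolding proportional_def by (intro exI[of _ 1] exI[of _ 0]) simp
next
  case False
  then show ?thesis
    unfolding proportional_def by (intro exI[of _ d] exI[of _ "- c"]) (simp add: mult.commute)
qed

lemma proportional_obtain_multiple:
  assumes "proportional u w" "w \<noteq> 0"
  obtains c where "u = c *\<^sub>R w"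
proof -
  obtain a b where ab: "a \<noteq> 0 \<or> b \<noteq> 0" "a *\<^sub>R u + b *\<^sub>R w = 0"
    using assms by (auto simp: proportional_def)
  with assms(2) have "a \<noteq> 0"
    by auto
  moreover have "a *\<^sub>R u = (- b) *\<^sub>R w"
    using ab(2) by (simp add: eq_neg_iff_add_eq_0)
  ultimately have "u = (- b / a) *\<^sub>R w"
    by (metis divide_inverse_commute scaleR_left_imp_eq scaleR_scaleR
        nonzero_mult_div_cancel_left times_divide_eq_right)
  then show ?thesis
    by (rule that)
qed

theorem theorem2p1:
  fixes A :: "real^3^'n"
  shows "infinity_harmonic heisenberg_metric flat_metric (\<lambda>X. A *v X) \<longleftrightarrow>
    column 3 A = 0 \<or>
    (proportional (column 1 A) (column 2 A) \<and>
     proportional (column 1 A) (column 3 A) \<and>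
     proportional (column 2 A) (column 3 A))"
proof -
  define A1 A2 A3 where A_defs: "A1 = column 1 A" "A2 = column 2 A" "A3 = column 3 A"
  let ?T = "\<lambda>x y. (2 * (A2 \<bullet> A3)) *\<^sub>R A1 - (2 * (A1 \<bullet> A3)) *\<^sub>R A2
      + x *\<^sub>R ((A3 \<bullet> A3) *\<^sub>R A1 - (A1 \<bullet> A3) *\<^sub>R A3)
      + y *\<^sub>R ((A3 \<bullet> A3) *\<^sub>R A2 - (A2 \<bullet> A3) *\<^sub>R A3)"
  have "(\<forall>x y. ?T x y = 0) \<longleftrightarrow>
    A3 = 0 \<or> (proportional A1 A2 \<and> proportional A1 A3 \<and> proportional A2 A3)"
  proof (cases "A3 = 0")
    case False
    show ?thesis
    proof
      assume T: "\<forall>x y. ?T x y = 0"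
      \<comment> \<open>The premise says that \<open>u\<close> equals its orthogonal projection onto
        the line spanned by \<open>A3\<close>.\<close>
      have multiple: "u = ((u \<bullet> A3) / (A3 \<bullet> A3)) *\<^sub>R A3"
        if "(A3 \<bullet> A3) *\<^sub>R u - (u \<bullet> A3) *\<^sub>R A3 = 0" for u
      proof -
        have "(A3 \<bullet> A3) *\<^sub>R u = (A3 \<bullet> A3) *\<^sub>R (((u \<bullet> A3) / (A3 \<bullet> A3)) *\<^sub>R A3)"
          using that False by simp
        then show ?thesis
          using False scaleR_left_imp_eq inner_eq_zero_iff by blast
      qed
      \<comment> \<open>Differences of values of the affine map isolate the coefficients of x and
        y.\<close>
      have "?T 1 0 - ?T 0 0 = 0" "?T 0 1 - ?T 0 0 = 0"
        by (simp_all only: T diff_0_right)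
      then have "(A3 \<bullet> A3) *\<^sub>R A1 - (A1 \<bullet> A3) *\<^sub>R A3 = 0"
        "(A3 \<bullet> A3) *\<^sub>R A2 - (A2 \<bullet> A3) *\<^sub>R A3 = 0"
        by simp_all
      with multiple obtain c d where "A1 = c *\<^sub>R A3" "A2 = d *\<^sub>R A3"
        by meson
      \<comment> \<open>\<open>scaleR_one\<close> presents \<open>A3\<close> itself as a multiple of
        \<open>A3\<close>.\<close>
      then show "A3 = 0 \<or> (proportional A1 A2 \<and> proportional A1 A3 \<and> proportional A2 A3)"
        using proportional_multiples[of _ A3] by (metis scaleR_one)
    next
      assume "A3 = 0 \<or> (proportional A1 A2 \<and> proportional A1 A3 \<and> proportional A2 A3)"
      with False obtain c d where "A1 = c *\<^sub>R A3" "A2 = d *\<^sub>R A3"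
        by (metis proportional_obtain_multiple)
      then show "\<forall>x y. ?T x y = 0"
        by (simp add: mult_ac)
    qed
  qed simp
  then show ?thesis
    by (simp add: infinity_harmonic_heisenberg_linear_iff A_defs)
qed

end
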